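(* Let $G$ be a connected bipartite graph on at least three vertices. Then the vertex set $V(G)$ can be partitioned into three sets, each of which is an independent isolating set of $G$.
   Context: Graphs are finite and simple. For a set $S$ of vertices of $G$, $N[S]$ denotes the closed neighborhood of $S$, i.e. $S$ together with all neighbors of vertices of $S$. A set $S\subseteq V(G)$ is an isolating set of $G$ if $G-N[S]$ contains no edge. An independent isolating set is an isolating set $S$ that is also an independent set (no two vertices of $S$ are adjacent). *)

theory Defs
  imports "Graph_Theory.Digraph_Component" "HOL-Library.Disjoint_Sets"
begin

text \<open>
  A finite simple graph is an instance of \<^locale>\<open>Digraph.graph\<close>: a finite, loop-free and symmetric
  digraph without parallel arcs, each undirected edge being a pair of opposite arcs.
\<close>

definition independent_set :: "('a, 'b) pre_digraph \<Rightarrow> 'a set \<Rightarrow> bool" where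
  "independent_set G S \<longleftrightarrow> S \<subseteq> verts G \<and> (\<forall>u\<in>S. \<forall>v\<in>S. \<not> u \<rightarrow>\<^bsub>G\<^esub> v)"

definition bipartite :: "('a, 'b) pre_digraph \<Rightarrow> bool" where
  "bipartite G \<longleftrightarrow>
     (\<exists>A B. A \<union> B = verts G \<and> A \<inter> B = {} \<and> independent_set G A \<and> independent_set G B)"

definition closed_neighborhood :: "('a, 'b) pre_digraph \<Rightarrow> 'a set \<Rightarrow> 'a set" where
  "closed_neighborhood G S = S \<union> {v. \<exists>u\<in>S. u \<rightarrow>\<^bsub>G\<^esub> v}"

definition isolating_set :: "('a, 'b) pre_digraph \<Rightarrow> 'a set \<Rightarrow> bool" where
  "isolating_set G S \<longleftrightarrow>
     S \<subseteq> verts G \<and> arcs (G \<restriction> (verts G - closed_neighborhood G S)) = {}"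

definition independent_isolating_set :: "('a, 'b) pre_digraph \<Rightarrow> 'a set \<Rightarrow> bool" where
  "independent_isolating_set G S \<longleftrightarrow> isolating_set G S \<and> independent_set G S"

end

theory Submission
  imports Defs
begin

text \<open>
  Call a proper colouring with three colours good if every edge, together with the neighbours of
  its two ends, sees all three colours. The colour classes of a good colouring are three independent
  isolating sets: an edge that survives the removal of the closed neighbourhood of a class would
  miss the colour of that class (\<open>colour_classes_partition\<close>).

  A good colouring is obtained by colouring each vertex with its distance from a root \<open>r\<close> modulo 3.
  In a bipartite graph the distances of adjacent vertices differ by exactly 1, so this colouring is
  proper. Let \<open>uv\<close> be an edge with \<open>u\<close> nearer to the root. If \<open>u\<close> is not the root, it has a neighbour
  one step nearer still, and this neighbour has the third colour. If \<open>u = r\<close>, the third colour has to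
  come from a neighbour of \<open>v\<close> at distance 2, that is, from any neighbour of \<open>v\<close> other than \<open>r\<close>. So
  the root must not be adjacent to a leaf. Such a root exists (\<open>root_not_adjacent_to_leaf\<close>): if
  there is a leaf, take it, for two adjacent leaves would be the whole graph; otherwise any vertex
  will do.
\<close>

section \<open>Distances in connected and bipartite graphs\<close>

definition hop_distance :: "('a, 'b) pre_digraph \<Rightarrow> 'a \<Rightarrow> 'a \<Rightarrow> nat" where
  "hop_distance G r v = (LEAST n. (r, v) \<in> arcs_ends G ^^ n)"

lemma hop_distance_walk:
  assumes "(r, v) \<in> (arcs_ends G)\<^sup>*"
  shows "(r, v) \<in> arcs_ends G ^^ hop_distance G r v"
  using assms unfolding hop_distance_def rtrancl_power by (rule LeastI_ex)

lemma hop_distance_le: "(r, v) \<in> arcs_ends G ^^ n \<Longrightarrow> hop_distance G r v \<le> n"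
  unfolding hop_distance_def by (rule Least_le)

lemma hop_distance_adj_le:
  assumes "(r, u) \<in> (arcs_ends G)\<^sup>*" "u \<rightarrow>\<^bsub>G\<^esub> v"
  shows "hop_distance G r v \<le> Suc (hop_distance G r u)"
  by (rule hop_distance_le) (use hop_distance_walk[OF assms(1)] assms(2) in auto)

lemma hop_distance_eq_0:
  assumes "(r, v) \<in> (arcs_ends G)\<^sup>*" "hop_distance G r v = 0"
  shows "v = r"
  using hop_distance_walk[OF assms(1)] assms(2) by simp

lemma hop_distance_predecessor:
  assumes "(r, v) \<in> (arcs_ends G)\<^sup>*" "hop_distance G r v = Suc n"
  obtains w where "w \<rightarrow>\<^bsub>G\<^esub> v" "hop_distance G r w = n"
proof -
  obtain w where w: "(r, w) \<in> arcs_ends G ^^ n" "w \<rightarrow>\<^bsub>G\<^esub> v"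
    using hop_distance_walk[OF assms(1)] assms(2) by auto
  have "hop_distance G r v \<le> Suc (hop_distance G r w)"
    using hop_distance_adj_le[OF relpow_imp_rtrancl[OF w(1)] w(2)] .
  with hop_distance_le[OF w(1)] assms(2) have "hop_distance G r w = n" by simp
  with w(2) show thesis by (rule that)
qed

lemma bipartite_walk_parity:
  assumes "\<And>u v. u \<rightarrow>\<^bsub>G\<^esub> v \<Longrightarrow> (u \<in> A) \<noteq> (v \<in> A)"
    and "(r, v) \<in> arcs_ends G ^^ n"
  shows "even n \<longleftrightarrow> (r \<in> A \<longleftrightarrow> v \<in> A)"
  using assms(2)
proof (induction n arbitrary: v)
  case 0
  then show ?case by simp
next
  case (Suc n)
  then obtain w where "(r, w) \<in> arcs_ends G ^^ n" "w \<rightarrow>\<^bsub>G\<^esub> v" by auto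
  with Suc.IH[of w] assms(1)[of w v] show ?case by auto
qed

lemma bipartite_adj_sides:
  assumes "bipartite G"
  obtains A where "\<And>u v. u \<rightarrow>\<^bsub>G\<^esub> v \<Longrightarrow> u \<in> verts G \<Longrightarrow> v \<in> verts G \<Longrightarrow> (u \<in> A) \<noteq> (v \<in> A)"
proof -
  obtain A B where "A \<union> B = verts G" "A \<inter> B = {}"
    and indep: "\<forall>u\<in>A. \<forall>v\<in>A. \<not> u \<rightarrow>\<^bsub>G\<^esub> v" "\<forall>u\<in>B. \<forall>v\<in>B. \<not> u \<rightarrow>\<^bsub>G\<^esub> v"
    using assms unfolding bipartite_def independent_set_def by (elim exE conjE)
  then have side: "x \<in> A \<or> x \<in> B" if "x \<in> verts G" for x
    using that by blast
  show thesis
  proof (rule that)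
    fix u v assume "u \<rightarrow>\<^bsub>G\<^esub> v" "u \<in> verts G" "v \<in> verts G"
    with side[of u] side[of v] indep \<open>A \<inter> B = {}\<close> show "(u \<in> A) \<noteq> (v \<in> A)" by auto
  qed
qed

text \<open>
  Walks to the two ends of an edge have lengths of opposite parity, while the triangle inequality
  lets the distances differ by at most 1.
\<close>

lemma bipartite_hop_distance_adj:
  assumes "Digraph.graph G" "bipartite G"
    and r: "\<And>v. v \<in> verts G \<Longrightarrow> (r, v) \<in> (arcs_ends G)\<^sup>*"
    and uv: "u \<rightarrow>\<^bsub>G\<^esub> v"
  shows "hop_distance G r v = Suc (hop_distance G r u) \<or>
         hop_distance G r u = Suc (hop_distance G r v)"
proof -
  interpret G: Digraph.graph G by fact
  obtain A where "\<And>u v. u \<rightarrow>\<^bsub>G\<^esub> v \<Longrightarrow> u \<in> verts G \<Longrightarrow> v \<in> verts G \<Longrightarrow> (u \<in> A) \<noteq> (v \<in> A)"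
    using bipartite_adj_sides[OF assms(2)] by blast
  then have A: "\<And>u v. u \<rightarrow>\<^bsub>G\<^esub> v \<Longrightarrow> (u \<in> A) \<noteq> (v \<in> A)"
    using G.adj_in_verts by blast
  have ru: "(r, u) \<in> (arcs_ends G)\<^sup>*" and rv: "(r, v) \<in> (arcs_ends G)\<^sup>*"
    using r G.adj_in_verts[OF uv] by auto
  have vu: "v \<rightarrow>\<^bsub>G\<^esub> u"
    using arcs_ends_symmetric[OF G.sym_arcs uv] .
  have "even (hop_distance G r u) \<noteq> even (hop_distance G r v)"
    using bipartite_walk_parity[OF A hop_distance_walk[OF ru]]
      bipartite_walk_parity[OF A hop_distance_walk[OF rv]] A[OF uv] by blast
  then have "hop_distance G r u \<noteq> hop_distance G r v" by auto
  with hop_distance_adj_le[OF ru uv] hop_distance_adj_le[OF rv vu] show ?thesis by linarith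
qed

lemma connected_symmetric_rtrancl:
  assumes "symmetric G" "Digraph_Component.connected G" "u \<in> verts G" "v \<in> verts G" "wf_digraph G"
  shows "(u, v) \<in> (arcs_ends G)\<^sup>*"
proof -
  interpret wf_digraph G by fact
  have "u \<rightarrow>\<^sup>*\<^bsub>mk_symmetric G\<^esub> v"
    using assms(2-4) unfolding connected_def strongly_connected_def by simp
  then have "u \<rightarrow>\<^sup>*\<^bsub>G\<^esub> v"
    using reachable_mk_symmetric_eq[OF assms(1)] by simp
  then show ?thesis by (rule reachable_rtranclI)
qed

section \<open>Choosing the root\<close>

lemma root_not_adjacent_to_leaf:
  assumes "Digraph.graph G" "Digraph_Component.connected G" "card (verts G) \<ge> 3"
  obtains r where "r \<in> verts G" "\<And>v. r \<rightarrow>\<^bsub>G\<^esub> v \<Longrightarrow> \<exists>w. v \<rightarrow>\<^bsub>G\<^esub> w \<and> w \<noteq> r"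
proof (cases "\<exists>l p. p \<rightarrow>\<^bsub>G\<^esub> l \<and> (\<forall>w. l \<rightarrow>\<^bsub>G\<^esub> w \<longrightarrow> w = p)")
  interpret G: Digraph.graph G by fact
  case True
  then obtain l p where lp: "p \<rightarrow>\<^bsub>G\<^esub> l" "\<And>w. l \<rightarrow>\<^bsub>G\<^esub> w \<Longrightarrow> w = p" by blast
  have lV: "l \<in> verts G"
    using G.adj_in_verts lp(1) by blast
  have "\<exists>w. p \<rightarrow>\<^bsub>G\<^esub> w \<and> w \<noteq> l"
  proof (rule ccontr)
    assume "\<not> ?thesis"
    \<comment> \<open>Two adjacent leaves form a connected component, which has too few vertices.\<close>
    with lp(2) have closed: "\<And>x y. x \<in> {l, p} \<Longrightarrow> x \<rightarrow>\<^bsub>G\<^esub> y \<Longrightarrow> y \<in> {l, p}" by blast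
    have "x \<in> {l, p}" if "(l, x) \<in> (arcs_ends G)\<^sup>*" for x
      using that by induction (use closed in blast)+
    then have "verts G \<subseteq> {l, p}"
      using connected_symmetric_rtrancl[OF G.sym_arcs assms(2) lV _ G.wf_digraph] by blast
    then have "card (verts G) \<le> card {l, p}" by (intro card_mono) auto
    also have "\<dots> \<le> 2" by (simp add: card_insert_if)
    finally show False using assms(3) by simp
  qed
  with lp(2) have "\<And>v. l \<rightarrow>\<^bsub>G\<^esub> v \<Longrightarrow> \<exists>w. v \<rightarrow>\<^bsub>G\<^esub> w \<and> w \<noteq> l" by blast
  with lV show thesis by (rule that)
next
  case False
  have "verts G \<noteq> {}" using assms(3) by auto
  then obtain r where "r \<in> verts G" by blast
  moreover have "\<exists>w. v \<rightarrow>\<^bsub>G\<^esub> w \<and> w \<noteq> r" if "r \<rightarrow>\<^bsub>G\<^esub> v" for v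
    using False that by blast
  ultimately show thesis by (rule that)
qed

section \<open>Colouring by distance modulo 3\<close>

text \<open>
  Away from the root the third colour lies on a shortest walk to \<open>u\<close>, one step before \<open>u\<close>. An
  edge at the root has no such step, which is where the choice of the root enters.
\<close>

lemma third_colour_adjacent:
  assumes "Digraph.graph G" "bipartite G"
    and r: "\<And>v. v \<in> verts G \<Longrightarrow> (r, v) \<in> (arcs_ends G)\<^sup>*"
    and root: "\<And>v. r \<rightarrow>\<^bsub>G\<^esub> v \<Longrightarrow> \<exists>w. v \<rightarrow>\<^bsub>G\<^esub> w \<and> w \<noteq> r"
    and uv: "u \<rightarrow>\<^bsub>G\<^esub> v" "hop_distance G r v = Suc (hop_distance G r u)"
  shows "\<exists>w. (u \<rightarrow>\<^bsub>G\<^esub> w \<or> v \<rightarrow>\<^bsub>G\<^esub> w) \<and>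
    hop_distance G r w mod 3 \<notin> {hop_distance G r u mod 3, hop_distance G r v mod 3}"
proof -
  interpret G: Digraph.graph G by fact
  have inV: "u \<in> verts G" "v \<in> verts G"
    using G.adj_in_verts[OF uv(1)] by auto
  show ?thesis
  proof (cases "hop_distance G r u")
    case 0
    then have "u = r"
      using hop_distance_eq_0 r inV by metis
    with root uv(1) obtain w where w: "v \<rightarrow>\<^bsub>G\<^esub> w" "w \<noteq> r" by blast
    have "hop_distance G r w \<noteq> 0"
      using hop_distance_eq_0 r G.adj_in_verts(2)[OF w(1)] w(2) by metis
    moreover have "hop_distance G r w = Suc (hop_distance G r v) \<or>
        hop_distance G r v = Suc (hop_distance G r w)"
      by (rule bipartite_hop_distance_adj[OF assms(1,2) _ w(1)]) (rule r)
    \<comment> \<open>The neighbours of \<open>v\<close> are at distance 0 or 2, and only the root is at distance 0.\<close>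
    ultimately have w2: "hop_distance G r w = 2"
      using uv(2) 0 by linarith
    have "hop_distance G r w mod 3 \<notin> {hop_distance G r u mod 3, hop_distance G r v mod 3}"
      unfolding uv(2) 0 w2 by simp
    with w(1) show ?thesis by blast
  next
    case (Suc n)
    obtain w where w: "w \<rightarrow>\<^bsub>G\<^esub> u" "hop_distance G r w = n"
      using hop_distance_predecessor[OF r[OF inV(1)] Suc] by blast
    have "n mod 3 \<noteq> Suc n mod 3" "n mod 3 \<noteq> Suc (Suc n) mod 3" by presburger+
    then have "hop_distance G r w mod 3 \<notin> {hop_distance G r u mod 3, hop_distance G r v mod 3}"
      unfolding uv(2) Suc w(2) by blast
    with arcs_ends_symmetric[OF G.sym_arcs w(1)] show ?thesis by blast
  qed
qed

text \<open>
  All three classes are nonempty because a single edge already sees every colour.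
\<close>

lemma colour_classes_partition:
  fixes G :: "('a, 'b) pre_digraph" and f :: "'a \<Rightarrow> nat"
  assumes "wf_digraph G" and lt: "\<And>v. f v < 3"
    and proper: "\<And>u v. u \<rightarrow>\<^bsub>G\<^esub> v \<Longrightarrow> f u \<noteq> f v"
    and third: "\<And>u v. u \<rightarrow>\<^bsub>G\<^esub> v \<Longrightarrow> \<exists>w. (u \<rightarrow>\<^bsub>G\<^esub> w \<or> v \<rightarrow>\<^bsub>G\<^esub> w) \<and> f w \<notin> {f u, f v}"
    and sym: "symmetric G" and edge: "arcs G \<noteq> {}"
  shows "\<exists>P. partition_on (verts G) P \<and> card P = 3 \<and> (\<forall>S\<in>P. independent_isolating_set G S)"
proof -
  interpret wf_digraph G by fact
  define S where "S i = {v \<in> verts G. f v = i}" for i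
  have seen: "\<exists>w\<in>S i. w = u \<or> w = v \<or> w \<rightarrow>\<^bsub>G\<^esub> u \<or> w \<rightarrow>\<^bsub>G\<^esub> v" if uv: "u \<rightarrow>\<^bsub>G\<^esub> v" and i: "i < 3" for u v i
  proof -
    obtain w where w: "u \<rightarrow>\<^bsub>G\<^esub> w \<or> v \<rightarrow>\<^bsub>G\<^esub> w" "f w \<notin> {f u, f v}"
      using third[OF uv] by blast
    have wV: "w \<in> verts G" "u \<in> verts G" "v \<in> verts G"
      using w(1) uv adj_in_verts by blast+
    have "i = f u \<or> i = f v \<or> i = f w"
      using lt[of u] lt[of v] lt[of w] proper[OF uv] w(2) i by auto
    moreover have "w \<rightarrow>\<^bsub>G\<^esub> u \<or> w \<rightarrow>\<^bsub>G\<^esub> v"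
      using w(1) arcs_ends_symmetric[OF sym] by blast
    ultimately show ?thesis using wV unfolding S_def by blast
  qed
  have iis: "independent_isolating_set G (S i)" if i: "i < 3" for i
  proof -
    have "\<not> (tail G e \<in> verts G - closed_neighborhood G (S i) \<and>
             head G e \<in> verts G - closed_neighborhood G (S i))" if "e \<in> arcs G" for e
      using seen[OF in_arcs_imp_in_arcs_ends[OF that] i] unfolding closed_neighborhood_def by blast
    then have "isolating_set G (S i)"
      unfolding isolating_set_def induce_subgraph_arcs by (auto simp: S_def)
    moreover have "independent_set G (S i)"
      unfolding independent_set_def S_def using proper by blast
    ultimately show ?thesis unfolding independent_isolating_set_def by blast
  qed
  obtain e where e: "e \<in> arcs G" using edge by blast
  have ne: "S i \<noteq> {}" if "i < 3" for i
    using seen[OF in_arcs_imp_in_arcs_ends[OF e] that] by blast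
  have "inj_on S {..<3}"
  proof (rule inj_onI)
    fix i j :: nat assume "i \<in> {..<3}" "S i = S j"
    moreover from this(1) ne obtain v where "v \<in> S i" by blast
    ultimately have "v \<in> S i" "v \<in> S j" by auto
    then show "i = j" by (simp add: S_def)
  qed
  then have "card (S ` {..<3}) = 3" by (simp add: card_image)
  moreover have "partition_on (verts G) (S ` {..<3})"
  proof (rule partition_onI)
    show "\<Union> (S ` {..<3}) = verts G" using lt by (auto simp: S_def)
    show "disjnt p q" if "p \<in> S ` {..<3}" "q \<in> S ` {..<3}" "p \<noteq> q" for p q
      using that by (auto simp: S_def disjnt_def)
    show "{} \<notin> S ` {..<3}" using ne by force
  qed
  ultimately show ?thesis using iis by (intro exI[of _ "S ` {..<3}"]) auto
qed

theorem theorem4: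
  fixes G :: "('a, 'b) pre_digraph"
  assumes "Digraph.graph G"
    and "Digraph_Component.connected G"
    and "bipartite G"
    and "card (verts G) \<ge> 3"
  shows "\<exists>P. partition_on (verts G) P \<and> card P = 3 \<and> (\<forall>S\<in>P. independent_isolating_set G S)"
proof -
  interpret G: Digraph.graph G by fact
  obtain r where rV: "r \<in> verts G" and root: "\<And>v. r \<rightarrow>\<^bsub>G\<^esub> v \<Longrightarrow> \<exists>w. v \<rightarrow>\<^bsub>G\<^esub> w \<and> w \<noteq> r"
    using root_not_adjacent_to_leaf[OF assms(1,2,4)] by blast
  have r: "(r, v) \<in> (arcs_ends G)\<^sup>*" if "v \<in> verts G" for v
    using connected_symmetric_rtrancl[OF G.sym_arcs assms(2) rV that G.wf_digraph] .
  have step: "hop_distance G r v = Suc (hop_distance G r u) \<or>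
      hop_distance G r u = Suc (hop_distance G r v)" if "u \<rightarrow>\<^bsub>G\<^esub> v" for u v
    by (rule bipartite_hop_distance_adj[OF assms(1,3) _ that]) (rule r)
  have third: "\<exists>w. (u \<rightarrow>\<^bsub>G\<^esub> w \<or> v \<rightarrow>\<^bsub>G\<^esub> w) \<and>
      hop_distance G r w mod 3 \<notin> {hop_distance G r u mod 3, hop_distance G r v mod 3}"
    if "u \<rightarrow>\<^bsub>G\<^esub> v" "hop_distance G r v = Suc (hop_distance G r u)" for u v
    by (rule third_colour_adjacent[OF assms(1,3) _ _ that]) (rule r root, assumption)+
  show ?thesis
  proof (rule colour_classes_partition[where f = "\<lambda>v. hop_distance G r v mod 3"])
    show "hop_distance G r u mod 3 \<noteq> hop_distance G r v mod 3" if "u \<rightarrow>\<^bsub>G\<^esub> v" for u v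
    proof -
      have succ: "n mod 3 \<noteq> Suc n mod 3" for n :: nat by presburger
      from step[OF that] show ?thesis
      proof
        assume "hop_distance G r v = Suc (hop_distance G r u)"
        then show ?thesis using succ by metis
      next
        assume "hop_distance G r u = Suc (hop_distance G r v)"
        then show ?thesis using succ by metis
      qed
    qed
    show "\<exists>w. (u \<rightarrow>\<^bsub>G\<^esub> w \<or> v \<rightarrow>\<^bsub>G\<^esub> w) \<and>
        hop_distance G r w mod 3 \<notin> {hop_distance G r u mod 3, hop_distance G r v mod 3}"
      if "u \<rightarrow>\<^bsub>G\<^esub> v" for u v
      using step[OF that]
    proof
      assume "hop_distance G r v = Suc (hop_distance G r u)"
      with that show ?thesis by (rule third)
    next
      assume "hop_distance G r u = Suc (hop_distance G r v)"
      then show ?thesis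
        using third[OF arcs_ends_symmetric[OF G.sym_arcs that]] by blast
    qed
    show "arcs G \<noteq> {}"
    proof
      assume "arcs G = {}"
      then have "verts G \<subseteq> {r}"
        using r by (auto simp: arcs_ends_def)
      then have "card (verts G) \<le> card {r}" by (intro card_mono) auto
      with assms(4) show False by simp
    qed
  qed (simp_all add: G.wf_digraph G.sym_arcs)
qed

end
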